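(* Let $\mathcal{H}$ be a nontrivial complex Hilbert space, let $A\in\mathcal{B}(\mathcal{H})$ be positive and nonzero, let $I$ be the identity operator on $\mathcal{H}$, and let $T\in\mathcal{B}_{A^{1/2}}(\mathcal{H})$. Then the following conditions are equivalent: (1) $T$ satisfies the $A$-Daugavet equation, i.e. $\|T+I\|_A=\|T\|_A+1$. (2) $\|T\|_A\in\overline{W_A(T)}$. (3) $I\perp_A^{BJ}\big(\|T\|_AI-T\big)$. (4) $T\perp_A^{BJ}\big(T-\|T\|_AI\big)$.
   Context: $\mathcal{B}(\mathcal{H})$ denotes the bounded linear operators on $\mathcal{H}$. Positive means $\langle Ax,x\rangle\ge 0$ for all $x$. Put $\langle x,y\rangle_A=\langle Ax,y\rangle$ and $\|x\|_A=\sqrt{\langle x,x\rangle_A}$. $\mathcal{B}_{A^{1/2}}(\mathcal{H})$ is the set of $A$-bounded operators, i.e. those $T\in\mathcal{B}(\mathcal{H})$ for which there is $c>0$ with $\|Tx\|_A\le c\|x\|_A$ for all $x\in\mathcal{H}$; for such $T$, $\|T\|_A=\sup\{\|Tx\|_A : x\in\mathcal{H},\ \|x\|_A=1\}$. The $A$-numerical range is $W_A(T)=\{\langle Tx,x\rangle_A : x\in\mathcal{H},\ \|x\|_A=1\}\subseteq\mathbb{C}$, and the bar denotes closure in $\mathbb{C}$. For $T,S\in\mathcal{B}_{A^{1/2}}(\mathcal{H})$, $T\perp_A^{BJ}S$ ($A$-Birkhoff-James orthogonal) means $\|T+\gamma S\|_A\ge\|T\|_A$ for all $\gamma\in\mathbb{C}$.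 *)

theory Defs
  imports "HOL-Analysis.Analysis"
begin

text \<open>
  Complex Hilbert spaces as an extension of the library's real Banach spaces. The inner product
  is linear in its first argument. Its positive definiteness is contained in
  \<open>cinner_self\<close>, because \<^const>\<open>norm\<close> is already a norm.
\<close>

class complex_hilbert_space = banach +
  fixes scaleC :: "complex \<Rightarrow> 'a \<Rightarrow> 'a" (infixr "*\<^sub>C" 75)
    and cinner :: "'a \<Rightarrow> 'a \<Rightarrow> complex"
  assumes scaleC_add_right: "a *\<^sub>C (x + y) = a *\<^sub>C x + a *\<^sub>C y"
    and scaleC_add_left: "(a + b) *\<^sub>C x = a *\<^sub>C x + b *\<^sub>C x"
    and scaleC_scaleC: "a *\<^sub>C b *\<^sub>C x = (a * b) *\<^sub>C x"
    and scaleC_one: "1 *\<^sub>C x = x"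
    and scaleC_of_real: "complex_of_real r *\<^sub>C x = r *\<^sub>R x"
    and cinner_add_left: "cinner (x + y) z = cinner x z + cinner y z"
    and cinner_scaleC_left: "cinner (a *\<^sub>C x) y = a * cinner x y"
    and cinner_commute: "cinner x y = cnj (cinner y x)"
    and cinner_self: "cinner x x = complex_of_real ((norm x)\<^sup>2)"

instantiation complex :: complex_hilbert_space
begin

definition scaleC_complex :: "complex \<Rightarrow> complex \<Rightarrow> complex"
  where "scaleC_complex a x = a * x"

definition cinner_complex :: "complex \<Rightarrow> complex \<Rightarrow> complex"
  where "cinner_complex x y = x * cnj y"

instance
  by standard
    (auto simp: scaleC_complex_def cinner_complex_def algebra_simps scaleR_conv_of_real
      simp flip: complex_norm_square)

end

definition bounded_clinear ::
    "('a::complex_hilbert_space \<Rightarrow> 'b::complex_hilbert_space) \<Rightarrow> bool"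
  where "bounded_clinear T \<longleftrightarrow> bounded_linear T \<and> (\<forall>a x. T (a *\<^sub>C x) = a *\<^sub>C T x)"

definition positive_operator :: "('a::complex_hilbert_space \<Rightarrow> 'a) \<Rightarrow> bool"
  where "positive_operator A \<longleftrightarrow>
    bounded_clinear A \<and> (\<forall>x. cinner (A x) x \<in> \<real>\<^sub>\<ge>\<^sub>0)"

definition A_inner :: "('a::complex_hilbert_space \<Rightarrow> 'a) \<Rightarrow> 'a \<Rightarrow> 'a \<Rightarrow> complex"
  where "A_inner A x y = cinner (A x) y"

text \<open>For positive \<open>A\<close> the value \<open>A_inner A x x\<close> is real, so \<^const>\<open>Re\<close> discards nothing.\<close>

definition A_norm :: "('a::complex_hilbert_space \<Rightarrow> 'a) \<Rightarrow> 'a \<Rightarrow> real"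
  where "A_norm A x = sqrt (Re (A_inner A x x))"

definition A_bounded_operators ::
    "('a::complex_hilbert_space \<Rightarrow> 'a) \<Rightarrow> ('a \<Rightarrow> 'a) set"
  where "A_bounded_operators A =
    {T. bounded_clinear T \<and> (\<exists>c>0. \<forall>x. A_norm A (T x) \<le> c * A_norm A x)}"

text \<open>
  The supremum is taken in the reals. It is the intended value when \<open>A\<close> is positive and nonzero
  and \<open>T\<close> is \<open>A\<close>-bounded: the set is then nonempty and bounded above.
\<close>

definition A_op_norm ::
    "('a::complex_hilbert_space \<Rightarrow> 'a) \<Rightarrow> ('a \<Rightarrow> 'a) \<Rightarrow> real"
  where "A_op_norm A T = Sup {A_norm A (T x) | x. A_norm A x = 1}"

definition A_numerical_range ::
    "('a::complex_hilbert_space \<Rightarrow> 'a) \<Rightarrow> ('a \<Rightarrow> 'a) \<Rightarrow> complex set"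
  where "A_numerical_range A T = {A_inner A (T x) x | x. A_norm A x = 1}"

text \<open>Intended for \<open>T\<close> and \<open>S\<close> in \<^term>\<open>A_bounded_operators A\<close>.\<close>

definition A_BJ_orthogonal ::
    "('a::complex_hilbert_space \<Rightarrow> 'a) \<Rightarrow> ('a \<Rightarrow> 'a) \<Rightarrow> ('a \<Rightarrow> 'a) \<Rightarrow> bool"
  where "A_BJ_orthogonal A T S \<longleftrightarrow>
    (\<forall>\<gamma>. A_op_norm A (\<lambda>x. T x + \<gamma> *\<^sub>C S x) \<ge> A_op_norm A T)"

definition A_Daugavet :: "('a::complex_hilbert_space \<Rightarrow> 'a) \<Rightarrow> ('a \<Rightarrow> 'a) \<Rightarrow> bool"
  where "A_Daugavet A T \<longleftrightarrow> A_op_norm A (\<lambda>x. T x + x) = A_op_norm A T + 1"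

end

theory Submission
  imports Defs
begin

text \<open>
  Write \<open>N\<close> for the \<open>A\<close>-norm of \<open>T\<close>. If \<open>N\<close> is a limit of points \<open>\<langle>Tx,x\<rangle>\<^sub>A\<close> with \<open>\<parallel>x\<parallel>\<^sub>A = 1\<close>, then
  Cauchy--Schwarz gives \<open>\<parallel>aT + bI\<parallel>\<^sub>A \<ge> \<bar>aN + b\<bar>\<close> for all complex \<open>a\<close>, \<open>b\<close>, and (1), (3), (4) are
  instances of this bound. Conversely, taking \<open>\<gamma> = -1/(N + 1)\<close> in (3) or (4) turns the operator in
  question into a multiple of \<open>T + I\<close> and yields (1), except that (4) is void when \<open>N = 0\<close>, in which
  case (2) is trivial. Finally, expanding \<open>\<parallel>Tx + x\<parallel>\<^sub>A\<^sup>2\<close> shows that (1) forces \<open>Re \<langle>Tx,x\<rangle>\<^sub>A\<close> to come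
  arbitrarily close to \<open>N\<close>; as \<open>\<bar>\<langle>Tx,x\<rangle>\<^sub>A\<bar> \<le> N\<close>, this gives (2).
\<close>

section \<open>The semi-inner product and seminorm induced by \<open>A\<close>\<close>

global_interpretation scaleC: vector_space "scaleC :: complex \<Rightarrow> 'a::complex_hilbert_space \<Rightarrow> 'a"
  by standard (simp_all add: scaleC_add_right scaleC_add_left scaleC_scaleC scaleC_one)

lemma cinner_add_right: "cinner x (y + z) = cinner x y + cinner x z"
  by (metis cinner_add_left cinner_commute complex_cnj_add)

lemma cinner_scaleC_right: "cinner x (a *\<^sub>C y) = cnj a * cinner x y"
  by (metis cinner_commute cinner_scaleC_left complex_cnj_mult)

locale nonzero_positive_operator =
  fixes A :: "'a::complex_hilbert_space \<Rightarrow> 'a"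
  assumes positive: "positive_operator A" and nonzero: "A \<noteq> (\<lambda>x. 0)"
begin

lemma A_add: "A (x + y) = A x + A y"
  using positive by (auto simp: positive_operator_def bounded_clinear_def bounded_linear.linear linear_add)

lemma A_scaleC: "A (a *\<^sub>C x) = a *\<^sub>C A x"
  using positive by (auto simp: positive_operator_def bounded_clinear_def)

lemmas A_inner_simps =
  A_inner_def A_add A_scaleC cinner_add_left cinner_add_right cinner_scaleC_left cinner_scaleC_right

lemma A_inner_nonneg: "A_inner A x x \<in> \<real>\<^sub>\<ge>\<^sub>0"
  using positive by (auto simp: positive_operator_def A_inner_def)

lemma A_inner_self: "A_inner A x x = complex_of_real ((A_norm A x)\<^sup>2)"
  using A_inner_nonneg[of x] by (auto simp: A_norm_def complex_nonneg_Reals_iff complex_eq_iff)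

lemma A_norm_nonneg [simp]: "A_norm A x \<ge> 0"
  using A_inner_nonneg[of x] by (auto simp: A_norm_def complex_nonneg_Reals_iff)

lemma A_inner_commute: "A_inner A y x = cnj (A_inner A x y)"
proof -
  have real: "Im (A_inner A z z) = 0" for z
    by (simp add: A_inner_self)
  show ?thesis
    \<comment> \<open>Reality at \<open>x + y\<close> makes the imaginary parts of the two mixed
      terms opposite; reality at \<open>x + \<i> *\<^sub>C y\<close> makes their real parts
      equal.\<close>
    using real[of x] real[of y] real[of "x + y"] real[of "x + \<i> *\<^sub>C y"]
    by (simp add: A_inner_simps complex_eq_iff algebra_simps)
qed

lemma A_norm_scaleC: "A_norm A (a *\<^sub>C x) = cmod a * A_norm A x"
proof -
  have "A_inner A (a *\<^sub>C x) (a *\<^sub>C x) = complex_of_real ((cmod a * A_norm A x)\<^sup>2)"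
    unfolding A_inner_def A_scaleC cinner_scaleC_left cinner_scaleC_right
    unfolding A_inner_def[symmetric] A_inner_self
    by (simp add: power_mult_distrib complex_norm_square[unfolded of_real_power] mult_ac)
  then show ?thesis
    using A_norm_nonneg[of x] by (subst A_norm_def) (simp del: of_real_mult of_real_power)
qed

lemma A_norm_add_square:
  "(A_norm A (x + y))\<^sup>2 = (A_norm A x)\<^sup>2 + (A_norm A y)\<^sup>2 + 2 * Re (A_inner A x y)"
proof -
  have "A_inner A (x + y) (x + y) = A_inner A x x + A_inner A y y + A_inner A x y + A_inner A y x"
    by (simp add: A_inner_simps)
  then have "Re (A_inner A (x + y) (x + y))
      = Re (A_inner A x x) + Re (A_inner A y y) + 2 * Re (A_inner A x y)"
    by (simp add: A_inner_commute[of y x])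
  then show ?thesis
    by (simp add: A_inner_self)
qed

lemma A_Cauchy_Schwarz: "cmod (A_inner A x y) \<le> A_norm A x * A_norm A y"
proof -
  let ?z = "A_inner A x y" and ?p = "(A_norm A x)\<^sup>2" and ?q = "(A_norm A y)\<^sup>2"
  \<comment> \<open>The right-hand side is the squared seminorm of
    \<open>x - (t * ?z) *\<^sub>C y\<close>, a quadratic in the real parameter
    \<open>t\<close>.\<close>
  have ineq: "0 \<le> ?p - 2 * t * (cmod ?z)\<^sup>2 + t\<^sup>2 * (cmod ?z)\<^sup>2 * ?q" for t :: real
  proof -
    let ?a = "- (complex_of_real t * ?z)"
    have "A_inner A x (?a *\<^sub>C y) = - complex_of_real (t * (cmod ?z)\<^sup>2)"
      unfolding A_inner_def cinner_scaleC_right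
      by (simp add: complex_norm_square[unfolded of_real_power] mult_ac)
    then have "(A_norm A (x + ?a *\<^sub>C y))\<^sup>2 = ?p - 2 * t * (cmod ?z)\<^sup>2 + t\<^sup>2 * (cmod ?z)\<^sup>2 * ?q"
      unfolding A_norm_add_square A_norm_scaleC by (simp add: norm_mult power_mult_distrib)
    then show ?thesis
      by (metis zero_le_power2)
  qed
  have "(cmod ?z)\<^sup>2 \<le> ?p * ?q"
  proof (cases "?q = 0")
    \<comment> \<open>As \<open>A\<close> may have a kernel, \<open>?q = 0\<close> does not force
      \<open>y = 0\<close>. The bound is then affine in \<open>t\<close>, and the chosen
      \<open>t\<close> would make it equal to -1.\<close>
    case True
    have "?z = 0"
    proof (rule ccontr)
      assume "?z \<noteq> 0"
      with True ineq[of "(?p + 1) / (2 * (cmod ?z)\<^sup>2)"] show False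
        by (simp add: field_simps)
    qed
    then show ?thesis by simp
  next
    case False
    then have "?q > 0" by simp
    moreover from this have "(1 / ?q)\<^sup>2 * (cmod ?z)\<^sup>2 * ?q = (cmod ?z)\<^sup>2 / ?q"
      by (simp add: power2_eq_square)
    \<comment> \<open>\<open>t = 1 / ?q\<close> minimises the quadratic.\<close>
    ultimately show ?thesis
      using ineq[of "1 / ?q"] by (simp add: pos_divide_le_eq)
  qed
  then show ?thesis
    by - (rule power2_le_imp_le, simp_all add: power_mult_distrib)
qed

lemma A_norm_triangle: "A_norm A (x + y) \<le> A_norm A x + A_norm A y"
proof (rule power2_le_imp_le)
  show "(A_norm A (x + y))\<^sup>2 \<le> (A_norm A x + A_norm A y)\<^sup>2"
    using A_Cauchy_Schwarz[of x y] complex_Re_le_cmod[of "A_inner A x y"]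
    by (simp add: A_norm_add_square power2_sum)
qed simp

text \<open>If \<open>A x \<noteq> 0\<close>, then \<open>A_inner A x (A x)\<close> is the squared
  norm of \<open>A x\<close>, so Cauchy-Schwarz prevents \<open>A_norm A x\<close> from vanishing
  and \<open>x\<close> can be normalised.\<close>

lemma ex_A_unit: "\<exists>x. A_norm A x = 1"
proof -
  obtain x where "A x \<noteq> 0"
    using nonzero by blast
  then have "A_inner A x (A x) \<noteq> 0"
    by (simp add: A_inner_def cinner_self)
  then have "A_norm A x \<noteq> 0"
    using A_Cauchy_Schwarz[of x "A x"] by auto
  then have "A_norm A (complex_of_real (1 / A_norm A x) *\<^sub>C x) = 1"
    by (simp add: A_norm_scaleC norm_divide)
  then show ?thesis ..
qed

section \<open>The operator seminorm as a supremum\<close>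

lemma A_op_norm_least:
  assumes "\<And>x. A_norm A x = 1 \<Longrightarrow> A_norm A (S x) \<le> c"
  shows "A_op_norm A S \<le> c"
  unfolding A_op_norm_def using assms ex_A_unit by (intro cSup_least) auto

text \<open>The constant \<open>c\<close> certifies that the real supremum is taken over a set
  bounded above.\<close>

lemma A_op_norm_upper:
  assumes "\<And>x. A_norm A x = 1 \<Longrightarrow> A_norm A (S x) \<le> c" and "A_norm A x = 1"
  shows "A_norm A (S x) \<le> A_op_norm A S"
  unfolding A_op_norm_def using assms by (intro cSup_upper bdd_aboveI[of _ c]) auto

lemma A_op_norm_approx:
  assumes "r < A_op_norm A S"
  obtains x where "A_norm A x = 1" "r < A_norm A (S x)"
  using A_op_norm_least[of S r] assms by (meson not_le)

lemma A_op_norm_id: "A_op_norm A (\<lambda>x. x) = 1"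
proof -
  have "{A_norm A x | x. A_norm A x = 1} = {1}"
    using ex_A_unit by auto
  then show ?thesis
    by (simp add: A_op_norm_def)
qed

end

section \<open>Norm bounds for linear combinations of \<open>T\<close> and the identity\<close>

locale A_bounded_operator = nonzero_positive_operator A
  for A :: "'a::complex_hilbert_space \<Rightarrow> 'a" +
  fixes T :: "'a \<Rightarrow> 'a"
  assumes A_bounded: "T \<in> A_bounded_operators A"
begin

abbreviation N :: real
  where "N \<equiv> A_op_norm A T"

lemma A_norm_le_N: "A_norm A x = 1 \<Longrightarrow> A_norm A (T x) \<le> N"
proof -
  obtain c where "\<And>x. A_norm A (T x) \<le> c * A_norm A x"
    using A_bounded by (auto simp: A_bounded_operators_def)
  then show "A_norm A x = 1 \<Longrightarrow> A_norm A (T x) \<le> N"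
    by (intro A_op_norm_upper[of T c]) (metis mult.right_neutral)
qed

lemma N_nonneg: "N \<ge> 0"
  using ex_A_unit A_norm_le_N A_norm_nonneg by (meson order_trans)

lemma cmod_numerical_le_N: "A_norm A x = 1 \<Longrightarrow> cmod (A_inner A (T x) x) \<le> N"
  using A_Cauchy_Schwarz[of "T x" x] A_norm_le_N[of x] by simp

text \<open>All operators in the orthogonality and Daugavet conditions have this form; the bound,
  uniform over unit vectors, makes their operator seminorms genuine suprema.\<close>

lemma A_norm_affine_le:
  assumes "A_norm A x = 1"
  shows "A_norm A (a *\<^sub>C T x + b *\<^sub>C x) \<le> cmod a * N + cmod b"
  using A_norm_triangle[of "a *\<^sub>C T x" "b *\<^sub>C x"] assms
    mult_left_mono[OF A_norm_le_N[OF assms], of "cmod a"]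
  by (simp add: A_norm_scaleC)

lemma A_norm_affine_le_op:
  assumes "A_norm A x = 1"
  shows "A_norm A (a *\<^sub>C T x + b *\<^sub>C x) \<le> A_op_norm A (\<lambda>x. a *\<^sub>C T x + b *\<^sub>C x)"
  using A_op_norm_upper[OF A_norm_affine_le assms] .

lemma A_op_norm_affine_le: "A_op_norm A (\<lambda>x. a *\<^sub>C T x + b *\<^sub>C x) \<le> cmod a * N + cmod b"
  by (intro A_op_norm_least A_norm_affine_le)

lemma A_op_norm_affine_ge:
  fixes a b :: complex
  assumes "complex_of_real N \<in> closure (A_numerical_range A T)"
  shows "cmod (a * N + b) \<le> A_op_norm A (\<lambda>x. a *\<^sub>C T x + b *\<^sub>C x)" (is "_ \<le> ?R")
proof -
  obtain f where f: "\<And>n. f n \<in> A_numerical_range A T" "f \<longlonglongrightarrow> complex_of_real N"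
    using assms by (auto simp: closure_sequential)
  have "cmod (a * f n + b) \<le> ?R" for n
  proof -
    obtain x where x: "A_norm A x = 1" "f n = A_inner A (T x) x"
      using f(1)[of n] by (auto simp: A_numerical_range_def)
    have "A_inner A x x = 1"
      using x(1) by (simp add: A_inner_self)
    \<comment> \<open>Pairing with the unit vector \<open>x\<close> turns the operator into this
      scalar.\<close>
    then have "a * f n + b = A_inner A (a *\<^sub>C T x + b *\<^sub>C x) x"
      by (simp add: x(2) A_inner_simps)
    with A_Cauchy_Schwarz[of "a *\<^sub>C T x + b *\<^sub>C x" x] A_norm_affine_le_op[of x a b] x(1)
    show ?thesis by simp
  qed
  moreover have "(\<lambda>n. cmod (a * f n + b)) \<longlonglongrightarrow> cmod (a * N + b)"
    by (intro tendsto_intros f)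
  ultimately show ?thesis
    by (intro LIMSEQ_le_const2) auto
qed

text \<open>Collects the coefficients of \<open>T\<close> and the identity, so that the preceding
  bounds apply.\<close>

lemma id_BJ_affine:
  fixes \<gamma> :: complex
  shows "(\<lambda>x. x + \<gamma> *\<^sub>C (N *\<^sub>R x - T x)) = (\<lambda>x. (- \<gamma>) *\<^sub>C T x + (1 + \<gamma> * N) *\<^sub>C x)"
  by (simp add: algebra_simps flip: scaleC_of_real)

lemma T_BJ_affine:
  fixes \<gamma> :: complex
  shows "(\<lambda>x. T x + \<gamma> *\<^sub>C (T x - N *\<^sub>R x)) = (\<lambda>x. (1 + \<gamma>) *\<^sub>C T x + (- (\<gamma> * N)) *\<^sub>C x)"
  by (simp add: algebra_simps flip: scaleC_of_real)

text \<open>Carries a lower bound for a multiple of \<open>T + I\<close> over to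
  \<open>T + I\<close> itself.\<close>

lemma A_op_norm_scaled_add_id_le:
  "A_op_norm A (\<lambda>x. a *\<^sub>C T x + a *\<^sub>C x) \<le> cmod a * A_op_norm A (\<lambda>x. T x + x)"
proof (rule A_op_norm_least)
  fix x assume x: "A_norm A x = 1"
  have "A_norm A (T x + x) \<le> A_op_norm A (\<lambda>x. T x + x)"
    using A_norm_affine_le_op[OF x, of 1 1] by simp
  then show "A_norm A (a *\<^sub>C T x + a *\<^sub>C x) \<le> cmod a * A_op_norm A (\<lambda>x. T x + x)"
    by (simp add: A_norm_scaleC mult_left_mono flip: scaleC_add_right)
qed

text \<open>The opposite inequality is the triangle inequality.\<close>

lemma DaugavetI: "N + 1 \<le> A_op_norm A (\<lambda>x. T x + x) \<Longrightarrow> A_Daugavet A T"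
  using A_op_norm_affine_le[of 1 1] by (simp add: A_Daugavet_def)

section \<open>The Daugavet equation and the numerical range\<close>

lemma Daugavet_imp_closure:
  assumes "A_Daugavet A T"
  shows "complex_of_real N \<in> closure (A_numerical_range A T)"
  unfolding closure_approachable
proof (intro allI impI)
  fix e :: real assume "e > 0"
  \<comment> \<open>Chosen so that the final estimate \<open>2 * (N + 1)\<^sup>2 * \<delta>\<close>
    equals \<open>e\<^sup>2\<close>.\<close>
  define \<delta> where "\<delta> = e\<^sup>2 / (2 * (N + 1)\<^sup>2)"
  have "\<delta> > 0"
    using \<open>e > 0\<close> N_nonneg by (simp add: \<delta>_def)
  moreover have "A_op_norm A (\<lambda>x. T x + x) = N + 1"
    using assms by (simp add: A_Daugavet_def)
  ultimately have "N + 1 - \<delta> < A_op_norm A (\<lambda>x. T x + x)"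
    by simp
  then obtain x where x: "A_norm A x = 1" "N + 1 - \<delta> < A_norm A (T x + x)"
    by (rule A_op_norm_approx)
  let ?z = "A_inner A (T x) x"
  have "(N + 1)\<^sup>2 - 2 * (N + 1) * \<delta> < (A_norm A (T x + x))\<^sup>2"
  \<comment> \<open>Squaring preserves the inequality only if its smaller side is nonnegative.
    Otherwise \<open>N + 1 < \<delta>\<close> and the claimed lower bound is itself
    negative.\<close>
  proof (cases "N + 1 - \<delta> \<ge> 0")
    case True
    then have "(N + 1 - \<delta>)\<^sup>2 < (A_norm A (T x + x))\<^sup>2"
      using x(2) by (intro power_strict_mono) auto
    then show ?thesis
      using zero_le_power2[of \<delta>] unfolding power2_diff by linarith
  next
    case False
    then have "(N + 1) * (N + 1) < (N + 1) * (2 * \<delta>)"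
      using N_nonneg \<open>\<delta> > 0\<close> by (intro mult_strict_left_mono) auto
    then have "(N + 1)\<^sup>2 - 2 * (N + 1) * \<delta> < 0"
      by (simp add: power2_eq_square algebra_simps)
    then show ?thesis
      by (rule less_le_trans) simp
  qed
  also have "(A_norm A (T x + x))\<^sup>2 \<le> N\<^sup>2 + 1 + 2 * Re ?z"
    using A_norm_le_N[OF x(1)] x(1) by (simp add: A_norm_add_square power_mono)
  finally have Re: "N - Re ?z < (N + 1) * \<delta>"
    by (simp add: power2_sum algebra_simps)
  have z: "(cmod ?z)\<^sup>2 \<le> N\<^sup>2"
    using cmod_numerical_le_N[OF x(1)] by (intro power_mono) auto
  have "(dist ?z N)\<^sup>2 = (cmod ?z)\<^sup>2 - 2 * N * Re ?z + N\<^sup>2"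
    unfolding dist_norm cmod_power2 by (simp add: power2_eq_square algebra_simps)
  \<comment> \<open>Because \<open>cmod ?z \<le> N\<close>, closeness of the real part to
    \<open>N\<close> controls the imaginary part too.\<close>
  also have "\<dots> \<le> 2 * N * (N - Re ?z)"
    using z by (simp add: algebra_simps power2_eq_square)
  also have "\<dots> \<le> 2 * N * ((N + 1) * \<delta>)"
    using Re N_nonneg by (intro mult_left_mono) auto
  \<comment> \<open>Enlarging \<open>N\<close> to \<open>N + 1\<close> keeps the inequality strict
    even when \<open>N = 0\<close>.\<close>
  also have "\<dots> < 2 * (N + 1) * ((N + 1) * \<delta>)"
    using N_nonneg \<open>\<delta> > 0\<close> by (intro mult_strict_right_mono) auto
  also have "\<dots> = 2 * (N + 1)\<^sup>2 * \<delta>"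
    by (simp add: power2_eq_square)
  also have "\<dots> = e\<^sup>2"
    using N_nonneg by (simp add: \<delta>_def)
  finally have "dist ?z N < e"
    using \<open>e > 0\<close> by (simp add: power2_less_imp_less)
  then show "\<exists>z\<in>A_numerical_range A T. dist z N < e"
    using x(1) by (auto simp: A_numerical_range_def)
qed

lemma closure_imp_Daugavet:
  assumes "complex_of_real N \<in> closure (A_numerical_range A T)"
  shows "A_Daugavet A T"
proof (rule DaugavetI)
  have "cmod (N + 1) = N + 1"
    using N_nonneg by (metis norm_of_real abs_of_nonneg add_nonneg_nonneg of_real_1 of_real_add zero_le_one)
  then show "N + 1 \<le> A_op_norm A (\<lambda>x. T x + x)"
    using A_op_norm_affine_ge[OF assms, of 1 1] by simp
qed

section \<open>Birkhoff-James orthogonality\<close>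

lemma closure_imp_id_BJ:
  assumes "complex_of_real N \<in> closure (A_numerical_range A T)"
  shows "A_BJ_orthogonal A (\<lambda>x. x) (\<lambda>x. N *\<^sub>R x - T x)"
  \<comment> \<open>The scalar in the lower bound is
    \<open>- \<gamma> * N + (1 + \<gamma> * N) = 1\<close>, whatever \<open>\<gamma>\<close>
    is.\<close>
  unfolding A_BJ_orthogonal_def id_BJ_affine A_op_norm_id
  using A_op_norm_affine_ge[OF assms, of "- \<gamma>" "1 + \<gamma> * N" for \<gamma> :: complex] by simp

lemma closure_imp_T_BJ:
  assumes "complex_of_real N \<in> closure (A_numerical_range A T)"
  shows "A_BJ_orthogonal A T (\<lambda>x. T x - N *\<^sub>R x)"
proof -
  \<comment> \<open>Here the scalar is \<open>(1 + \<gamma>) * N - \<gamma> * N = N\<close>, again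
    independent of \<open>\<gamma>\<close>.\<close>
  have "N \<le> A_op_norm A (\<lambda>x. (1 + \<gamma>) *\<^sub>C T x + (- (\<gamma> * N)) *\<^sub>C x)"
    for \<gamma> :: complex
    using A_op_norm_affine_ge[OF assms, of "1 + \<gamma>" "- (\<gamma> * N)"] N_nonneg
    by (simp add: distrib_right)
  then show ?thesis
    by (simp add: A_BJ_orthogonal_def T_BJ_affine del: scaleC.scale_minus_left)
qed

lemma id_BJ_imp_Daugavet:
  assumes "A_BJ_orthogonal A (\<lambda>x. x) (\<lambda>x. N *\<^sub>R x - T x)"
  shows "A_Daugavet A T"
proof (rule DaugavetI)
  \<comment> \<open>The solution of \<open>1 - a * N = a\<close>: at \<open>\<gamma> = - a\<close>
    the coefficients of \<open>T\<close> and the identity coincide.\<close>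
  define a where "a = complex_of_real (1 / (N + 1))"
  have a: "1 + - a * N = a" "cmod a = 1 / (N + 1)"
  proof -
    have "1 - 1 / (N + 1) * N = 1 / (N + 1)"
      using N_nonneg by (simp add: field_simps)
    from arg_cong[OF this, of complex_of_real] show "1 + - a * N = a"
      by (simp add: a_def)
    show "cmod a = 1 / (N + 1)"
      unfolding a_def norm_of_real using N_nonneg by simp
  qed
  have "1 \<le> A_op_norm A (\<lambda>x. a *\<^sub>C T x + a *\<^sub>C x)"
    using assms[unfolded A_BJ_orthogonal_def id_BJ_affine A_op_norm_id, rule_format, of "- a"]
    by (simp only: a minus_minus)
  also have "\<dots> \<le> 1 / (N + 1) * A_op_norm A (\<lambda>x. T x + x)"
    using A_op_norm_scaled_add_id_le[of a] by (simp only: a)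
  finally show "N + 1 \<le> A_op_norm A (\<lambda>x. T x + x)"
    using N_nonneg by (simp add: field_simps)
qed

lemma T_BJ_imp_closure:
  assumes "A_BJ_orthogonal A T (\<lambda>x. T x - N *\<^sub>R x)"
  shows "complex_of_real N \<in> closure (A_numerical_range A T)"
proof (cases "N = 0")
  case True
  obtain x where x: "A_norm A x = 1"
    using ex_A_unit by blast
  \<comment> \<open>Values of the numerical range have modulus at most \<open>N = 0\<close>.\<close>
  then have "A_inner A (T x) x = complex_of_real N"
    using cmod_numerical_le_N[OF x] True by simp
  then have "complex_of_real N \<in> A_numerical_range A T"
    using x unfolding A_numerical_range_def by (auto intro: sym)
  then show ?thesis
    using closure_subset by blast
next
  case False
  with N_nonneg have "N > 0" by simp
  \<comment> \<open>\<open>g\<close> solves \<open>1 + g = - (g * N)\<close>, which equates the two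
    coefficients; \<open>a\<close> is their common value.\<close>
  define a where "a = complex_of_real (N / (N + 1))"
  define g where "g = - complex_of_real (1 / (N + 1))"
  have a: "1 + g = a" "- (g * N) = a" "cmod a = N / (N + 1)"
  proof -
    have "1 - 1 / (N + 1) = N / (N + 1)"
      using N_nonneg by (simp add: field_simps)
    from arg_cong[OF this, of complex_of_real] show "1 + g = a"
      by (simp add: a_def g_def)
    show "- (g * N) = a"
      by (simp add: a_def g_def)
    show "cmod a = N / (N + 1)"
      unfolding a_def norm_of_real using N_nonneg by simp
  qed
  have "N \<le> A_op_norm A (\<lambda>x. a *\<^sub>C T x + a *\<^sub>C x)"
    using assms[unfolded A_BJ_orthogonal_def T_BJ_affine, rule_format, of g] by (simp only: a)
  also have "\<dots> \<le> N / (N + 1) * A_op_norm A (\<lambda>x. T x + x)"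
    using A_op_norm_scaled_add_id_le[of a] by (simp only: a)
  finally have "N * (N + 1) \<le> N * A_op_norm A (\<lambda>x. T x + x)"
    using N_nonneg by (simp add: pos_le_divide_eq)
  \<comment> \<open>Cancelling the factor \<open>N\<close> is where the case \<open>N > 0\<close>
    enters.\<close>
  then have "N + 1 \<le> A_op_norm A (\<lambda>x. T x + x)"
    using \<open>N > 0\<close> by (rule mult_left_le_imp_le)
  then show ?thesis
    by (intro Daugavet_imp_closure DaugavetI)
qed

end

theorem theorem3p2:
  fixes A T :: "'a::complex_hilbert_space \<Rightarrow> 'a"
  assumes "\<exists>x::'a. x \<noteq> 0"
    and "positive_operator A"
    and "A \<noteq> (\<lambda>x. 0)"
    and "T \<in> A_bounded_operators A"
  shows "(A_Daugavet A T
          \<longleftrightarrow> complex_of_real (A_op_norm A T) \<in> closure (A_numerical_range A T))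
    \<and> (complex_of_real (A_op_norm A T) \<in> closure (A_numerical_range A T)
          \<longleftrightarrow> A_BJ_orthogonal A (\<lambda>x. x) (\<lambda>x. A_op_norm A T *\<^sub>R x - T x))
    \<and> (A_BJ_orthogonal A (\<lambda>x. x) (\<lambda>x. A_op_norm A T *\<^sub>R x - T x)
          \<longleftrightarrow> A_BJ_orthogonal A T (\<lambda>x. T x - A_op_norm A T *\<^sub>R x))"
proof -
  interpret A_bounded_operator A T
    using assms by unfold_locales
  show ?thesis
    using Daugavet_imp_closure closure_imp_Daugavet closure_imp_id_BJ id_BJ_imp_Daugavet
      closure_imp_T_BJ T_BJ_imp_closure by blast
qed

end
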